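(* Let $D\subseteq\mathbb{R}$ be an open interval, let $f:D\to\mathbb{R}$ be a sufficiently differentiable function, and let $\alpha\in D$ be a simple root of $f(x)=0$. Let $A$ be a sufficiently differentiable real weight function of one real variable defined near $0$, and consider the iterative scheme $$y_n=x_n-\frac{f(x_n)}{f'(x_n)},\qquad z_n=y_n-A(t_1)\frac{f(y_n)}{f'(x_n)},\qquad x_{n+1}=z_n-\frac{f(z_n)}{f[z_n,y_n]+f[z_n,x_n,x_n](z_n-y_n)},$$ where $t_1=\frac{f(y_n)}{f(x_n)}$. If $x_0$ is chosen sufficiently close to $\alpha$, then the following hold. (i) If $A(0)=1$, then the scheme converges to $\alpha$ with convergence order at least six. (ii) If $A(0)=1$ and $\frac{dA}{dt_1}(0)=2$, then the scheme has convergence order at least seven.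
   Context: Divided differences: $f[a,b]=\frac{f(a)-f(b)}{a-b}$ for $a\ne b$, and $f[z_n,x_n,x_n]=\frac{f[z_n,x_n]-f'(x_n)}{z_n-x_n}$. Write $e_n=x_n-\alpha$. Convergence order at least $p$ means that the error satisfies $e_{n+1}=K e_n^{p}+O(e_n^{p+1})$ as $x_n\to\alpha$, where $K$ is a constant depending on $f$ and the weight function (possibly zero). The iteration formulas are understood at steps where all denominators are nonzero. *)

theory Defs
  imports "HOL-Analysis.Analysis" "HOL-Library.Landau_Symbols"
begin

text \<open>
  \<open>k\<close> times continuously differentiable; meant for open \<open>S\<close>, where the two-sided derivative
  \<^const>\<open>deriv\<close> is the right notion.
\<close>
definition cont_diff_on :: "nat \<Rightarrow> (real \<Rightarrow> real) \<Rightarrow> real set \<Rightarrow> bool" where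
  "cont_diff_on k f S \<longleftrightarrow>
     (\<forall>j<k. (deriv ^^ j) f differentiable_on S) \<and> continuous_on S ((deriv ^^ k) f)"

definition div_diff :: "(real \<Rightarrow> real) \<Rightarrow> real \<Rightarrow> real \<Rightarrow> real" where
  "div_diff f a b = (f a - f b) / (a - b)"

text \<open>\<open>f[z, x, x]\<close>, with a double node at \<open>x\<close>\<close>
definition div_diff_double :: "(real \<Rightarrow> real) \<Rightarrow> real \<Rightarrow> real \<Rightarrow> real" where
  "div_diff_double f z x = (div_diff f z x - deriv f x) / (z - x)"

definition newton_pt :: "(real \<Rightarrow> real) \<Rightarrow> real \<Rightarrow> real" where
  "newton_pt f x = x - f x / deriv f x"

definition weight_arg :: "(real \<Rightarrow> real) \<Rightarrow> real \<Rightarrow> real" where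
  "weight_arg f x = f (newton_pt f x) / f x"

definition weighted_pt :: "(real \<Rightarrow> real) \<Rightarrow> (real \<Rightarrow> real) \<Rightarrow> real \<Rightarrow> real" where
  "weighted_pt f A x =
     newton_pt f x - A (weight_arg f x) * (f (newton_pt f x) / deriv f x)"

definition slope_approx :: "(real \<Rightarrow> real) \<Rightarrow> (real \<Rightarrow> real) \<Rightarrow> real \<Rightarrow> real" where
  "slope_approx f A x =
     (let y = newton_pt f x; z = weighted_pt f A x
      in div_diff f z y + div_diff_double f z x * (z - y))"

definition scheme_step :: "(real \<Rightarrow> real) \<Rightarrow> (real \<Rightarrow> real) \<Rightarrow> real \<Rightarrow> real" where
  "scheme_step f A x =
     weighted_pt f A x - f (weighted_pt f A x) / slope_approx f A x"

text \<open>
  All denominators occurring in \<^term>\<open>scheme_step f A x\<close> are nonzero. In particular this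
  excludes \<open>x\<close> and \<open>newton_pt f x\<close> being a root of \<open>f\<close> (in the latter case
  \<open>weighted_pt f A x = newton_pt f x\<close>), so no value of a division by zero is ever used below.
\<close>
definition step_defined :: "(real \<Rightarrow> real) \<Rightarrow> (real \<Rightarrow> real) \<Rightarrow> real \<Rightarrow> bool" where
  "step_defined f A x \<longleftrightarrow>
     deriv f x \<noteq> 0 \<and> f x \<noteq> 0 \<and>
     weighted_pt f A x \<noteq> newton_pt f x \<and> weighted_pt f A x \<noteq> x \<and>
     slope_approx f A x \<noteq> 0"

definition scheme_seq :: "(real \<Rightarrow> real) \<Rightarrow> (real \<Rightarrow> real) \<Rightarrow> (nat \<Rightarrow> real) \<Rightarrow> bool" where
  "scheme_seq f A x \<longleftrightarrow>
     (\<forall>n. step_defined f A (x n) \<and> x (Suc n) = scheme_step f A (x n))"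

definition locally_convergent :: "(real \<Rightarrow> real) \<Rightarrow> (real \<Rightarrow> real) \<Rightarrow> real \<Rightarrow> bool" where
  "locally_convergent f A \<alpha> \<longleftrightarrow>
     (\<exists>\<delta>>0. \<forall>x. scheme_seq f A x \<and> \<bar>x 0 - \<alpha>\<bar> < \<delta> \<longrightarrow> x \<longlonglongrightarrow> \<alpha>)"

text \<open>
  \<open>e\<^sub>n\<^sub>+\<^sub>1 = K e\<^sub>n\<^sup>p + O(e\<^sub>n\<^sup>p\<^sup>+\<^sup>1)\<close> as \<open>x\<^sub>n \<rightarrow> \<alpha>\<close>, where \<open>x\<close> plays the role of \<open>x\<^sub>n\<close>. The constant \<open>K\<close> may be
  zero, and neither it nor the \<open>O\<close>-constant depends on a starting value.
\<close>
definition order_at_least :: "nat \<Rightarrow> (real \<Rightarrow> real) \<Rightarrow> (real \<Rightarrow> real) \<Rightarrow> real \<Rightarrow> bool" where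
  "order_at_least p f A \<alpha> \<longleftrightarrow>
     (\<exists>K. (\<lambda>x. (scheme_step f A x - \<alpha>) - K * (x - \<alpha>) ^ p)
        \<in> O[at \<alpha> within {x. step_defined f A x}](\<lambda>x. (x - \<alpha>) ^ (p + 1)))"

end

theory Submission
  imports Defs
begin

text \<open>
  Write \<open>e = x - \<alpha>\<close>, \<open>Y = y - \<alpha>\<close>, \<open>Z = z - \<alpha>\<close> and \<open>c\<^sub>2 = f''(\<alpha>) / (2 f'(\<alpha>))\<close>. Newton's step gives
  \<open>Y = e\<^sup>2 q\<close> with \<open>q = c\<^sub>2 + O(e)\<close>, and with \<open>A(0) = 1\<close> the weighted step gives \<open>Z = e\<^sup>2 w\<close> with
  \<open>w = (2 - A'(0)) c\<^sub>2\<^sup>2 e + O(e\<^sup>2)\<close>. The denominator \<open>S\<close> of the last step differs from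
  \<open>f(z) / (z - \<alpha>)\<close> by \<open>e\<^sup>2 s\<close> with \<open>s = O(e)\<close>, up to a negligible term, so the new error
  \<open>(Z S - f(z)) / S\<close> is \<open>e\<^sup>4 w s / S\<close> up to \<open>O(e\<^sup>8)\<close>. Hence the order is six, and it is seven if
  \<open>A'(0) = 2\<close> removes the linear term of \<open>w\<close>. Remainders of divided differences are controlled by the
  mean value theorem applied to \<open>f\<close> minus its Taylor polynomial, which avoids dividing by the
  distances of nodes whose order of magnitude is unknown.
\<close>

section \<open>Arithmetic of expansions to second order with a cubic remainder\<close>

text \<open>
  The coefficient of \<open>e\<^sup>2\<close> is left existential: its value only ends up in the asymptotic constant.
\<close>
definition quad_expansion :: "'a filter \<Rightarrow> ('a \<Rightarrow> real) \<Rightarrow> ('a \<Rightarrow> real) \<Rightarrow> real \<Rightarrow> real \<Rightarrow> bool" where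
  "quad_expansion F e u a b \<longleftrightarrow>
     (\<exists>c. (\<lambda>x. u x - (a + b * e x + c * e x ^ 2)) \<in> O[F](\<lambda>x. e x ^ 3))"

lemma quad_expansionI:
  "(\<lambda>x. u x - (a + b * e x + c * e x ^ 2)) \<in> O[F](\<lambda>x. e x ^ 3) \<Longrightarrow> quad_expansion F e u a b"
  unfolding quad_expansion_def by (rule exI)

lemma quad_expansion_cong:
  assumes "quad_expansion F e u a b" "eventually (\<lambda>x. u x = v x) F" "a = a'" "b = b'"
  shows "quad_expansion F e v a' b'"
proof -
  obtain c where c: "(\<lambda>x. u x - (a + b * e x + c * e x ^ 2)) \<in> O[F](\<lambda>x. e x ^ 3)"
    using assms(1) by (auto simp: quad_expansion_def)
  have "(\<lambda>x. v x - (a' + b' * e x + c * e x ^ 2)) \<in> O[F](\<lambda>x. e x ^ 3)"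
    by (rule landau_o.big.in_cong[THEN iffD1, OF _ c]) (use assms in \<open>auto elim: eventually_mono\<close>)
  then show ?thesis by (rule quad_expansionI)
qed

lemma quad_expansion_eq:
  "quad_expansion F e u a b \<Longrightarrow> a = a' \<Longrightarrow> b = b' \<Longrightarrow> quad_expansion F e u a' b'"
  by simp

lemma quad_expansion_const: "quad_expansion F e (\<lambda>x. a) a 0"
  by (rule quad_expansionI[where c = 0]) simp

lemma quad_expansion_base: "quad_expansion F e e 0 1"
  by (rule quad_expansionI[where c = 0]) simp

lemma quad_expansion_bigo:
  "u \<in> O[F](\<lambda>x. e x ^ 3) \<Longrightarrow> quad_expansion F e u 0 0"
  by (rule quad_expansionI[where c = 0]) simp

lemma quad_expansion_add:
  assumes "quad_expansion F e u a b" "quad_expansion F e v a' b'"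
  shows "quad_expansion F e (\<lambda>x. u x + v x) (a + a') (b + b')"
proof -
  obtain c c' where "(\<lambda>x. u x - (a + b * e x + c * e x ^ 2)) \<in> O[F](\<lambda>x. e x ^ 3)"
    "(\<lambda>x. v x - (a' + b' * e x + c' * e x ^ 2)) \<in> O[F](\<lambda>x. e x ^ 3)"
    using assms by (auto simp: quad_expansion_def)
  from sum_in_bigo(1)[OF this] show ?thesis
    by (intro quad_expansionI[where c = "c + c'"]) (simp add: algebra_simps)
qed

lemma quad_expansion_diff:
  assumes "quad_expansion F e u a b" "quad_expansion F e v a' b'"
  shows "quad_expansion F e (\<lambda>x. u x - v x) (a - a') (b - b')"
proof -
  obtain c c' where "(\<lambda>x. u x - (a + b * e x + c * e x ^ 2)) \<in> O[F](\<lambda>x. e x ^ 3)"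
    "(\<lambda>x. v x - (a' + b' * e x + c' * e x ^ 2)) \<in> O[F](\<lambda>x. e x ^ 3)"
    using assms by (auto simp: quad_expansion_def)
  from sum_in_bigo(2)[OF this] show ?thesis
    by (intro quad_expansionI[where c = "c - c'"]) (simp add: algebra_simps)
qed

lemma smallo_1_iff_tendsto:
  fixes u :: "'a \<Rightarrow> real"
  shows "u \<in> o[F](\<lambda>_. 1) \<longleftrightarrow> (u \<longlongrightarrow> 0) F"
  using smalloI_tendsto[of u "\<lambda>_. 1" F] smalloD_tendsto[of u F "\<lambda>_. 1"] by auto

lemma power_in_bigo_power:
  fixes e :: "'a \<Rightarrow> real"
  assumes "(e \<longlongrightarrow> 0) F" "m \<le> n"
  shows "(\<lambda>x. e x ^ n) \<in> O[F](\<lambda>x. e x ^ m)"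
proof -
  have "eventually (\<lambda>x. norm (e x) < 1) F"
    using assms(1) by (auto simp: tendsto_iff dist_norm)
  then show ?thesis
    by (intro landau_o.bigI[where c = 1])
       (auto elim!: eventually_mono simp: power_abs intro!: power_decreasing assms)
qed

lemma quad_expansion_tendsto:
  assumes "(e \<longlongrightarrow> 0) F" "quad_expansion F e u a b"
  shows "(u \<longlongrightarrow> a) F"
proof -
  obtain c where c: "(\<lambda>x. u x - (a + b * e x + c * e x ^ 2)) \<in> O[F](\<lambda>x. e x ^ 3)"
    using assms(2) by (auto simp: quad_expansion_def)
  have "((\<lambda>x. e x ^ 3) \<longlongrightarrow> 0) F" using tendsto_power[OF assms(1), of 3] by simp
  then have "(\<lambda>x. e x ^ 3) \<in> o[F](\<lambda>_. 1)" by (simp add: smallo_1_iff_tendsto)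
  then have "((\<lambda>x. u x - (a + b * e x + c * e x ^ 2)) \<longlongrightarrow> 0) F"
    by (intro smallo_1_iff_tendsto[THEN iffD1] landau_o.big_small_trans[OF c])
  moreover have "((\<lambda>x. a + b * e x + c * e x ^ 2) \<longlongrightarrow> a + b * 0 + c * 0 ^ 2) F"
    by (intro tendsto_intros assms)
  ultimately show ?thesis using tendsto_add by fastforce
qed

lemma bigo_divide_power:
  fixes e r :: "'a \<Rightarrow> real"
  assumes "r \<in> O[F](\<lambda>x. e x ^ (n + k))" "eventually (\<lambda>x. e x \<noteq> 0) F"
  shows "(\<lambda>x. r x / e x ^ k) \<in> O[F](\<lambda>x. e x ^ n)"
proof -
  obtain c where c: "eventually (\<lambda>x. norm (r x) \<le> c * norm (e x ^ (n + k))) F"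
    using assms(1) by (auto elim: landau_o.bigE)
  show ?thesis
  proof (rule bigoI)
    show "eventually (\<lambda>x. norm (r x / e x ^ k) \<le> c * norm (e x ^ n)) F"
      using c assms(2) by eventually_elim (simp add: power_add norm_mult norm_divide norm_power abs_mult field_simps)
  qed
qed

lemma tendsto_in_bigo_1:
  fixes u :: "'a \<Rightarrow> real"
  assumes "(u \<longlongrightarrow> a) F"
  shows "u \<in> O[F](\<lambda>_. 1)"
  using assms by (intro bigoI_tendsto[of _ _ a]) auto

lemma quad_expansion_bounded:
  assumes "(e \<longlongrightarrow> 0) F" "quad_expansion F e u a b"
  shows "u \<in> O[F](\<lambda>_. 1)"
  by (rule tendsto_in_bigo_1[OF quad_expansion_tendsto[OF assms]])

lemma quad_expansion_linear:
  assumes "(e \<longlongrightarrow> 0) F" "quad_expansion F e u a b"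
  shows "(\<lambda>x. u x - (a + b * e x)) \<in> O[F](\<lambda>x. e x ^ 2)"
proof -
  obtain c where c: "(\<lambda>x. u x - (a + b * e x + c * e x ^ 2)) \<in> O[F](\<lambda>x. e x ^ 3)"
    using assms(2) by (auto simp: quad_expansion_def)
  have "(\<lambda>x. (u x - (a + b * e x + c * e x ^ 2)) + c * e x ^ 2) \<in> O[F](\<lambda>x. e x ^ 2)"
    using landau_o.big_trans[OF c power_in_bigo_power[OF assms(1)]] by (intro sum_in_bigo(1)) simp_all
  then show ?thesis by (simp add: algebra_simps)
qed

lemma quad_expansion_mult:
  assumes e: "(e \<longlongrightarrow> 0) F"
    and u: "quad_expansion F e u a b" and v: "quad_expansion F e v a' b'"
  shows "quad_expansion F e (\<lambda>x. u x * v x) (a * a') (a * b' + b * a')"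
proof -
  obtain c c' where c: "(\<lambda>x. u x - (a + b * e x + c * e x ^ 2)) \<in> O[F](\<lambda>x. e x ^ 3)"
    and c': "(\<lambda>x. v x - (a' + b' * e x + c' * e x ^ 2)) \<in> O[F](\<lambda>x. e x ^ 3)"
    using u v by (auto simp: quad_expansion_def)
  define p where "p x = a + b * e x + c * e x ^ 2" for x
  define p' where "p' x = a' + b' * e x + c' * e x ^ 2" for x
  \<comment> \<open>The truncated product \<open>p x * p' x\<close> has degree four in
    \<open>e x\<close>; its terms of degree three and four are \<open>r x * e x ^ 3\<close>. The two
    factors are then exchanged one at a time:
    \<open>u * v - p * p' = (u - p) * v + p * (v - p')\<close>.\<close>
  define r where "r x = b * c' + c * b' + c * c' * e x" for x
  have "(p \<longlongrightarrow> a + b * 0 + c * 0 ^ 2) F" "(r \<longlongrightarrow> b * c' + c * b' + c * c' * 0) F"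
    unfolding p_def r_def by (intro tendsto_intros e)+
  then have p: "p \<in> O[F](\<lambda>_. 1)" and r: "r \<in> O[F](\<lambda>_. 1)"
    by (auto intro: tendsto_in_bigo_1)
  have 1: "(\<lambda>x. (u x - p x) * v x) \<in> O[F](\<lambda>x. e x ^ 3 * 1)"
    using c unfolding p_def by (intro landau_o.big.mult quad_expansion_bounded[OF e v])
  have 2: "(\<lambda>x. p x * (v x - p' x)) \<in> O[F](\<lambda>x. 1 * e x ^ 3)"
    using c' unfolding p'_def by (intro landau_o.big.mult p)
  have 3: "(\<lambda>x. r x * e x ^ 3) \<in> O[F](\<lambda>x. 1 * e x ^ 3)"
    by (intro landau_o.big.mult r landau_o.big_refl)
  have "(\<lambda>x. (u x - p x) * v x + p x * (v x - p' x) + r x * e x ^ 3) \<in> O[F](\<lambda>x. e x ^ 3)"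
    using sum_in_bigo(1)[OF sum_in_bigo(1)[OF 1[simplified] 2[simplified]] 3[simplified]] .
  moreover have "(u x - p x) * v x + p x * (v x - p' x) + r x * e x ^ 3 =
      u x * v x - (a * a' + (a * b' + b * a') * e x + (a * c' + b * b' + c * a') * e x ^ 2)" for x
    unfolding p_def p'_def r_def by algebra
  ultimately show ?thesis
    by (intro quad_expansionI[where c = "a * c' + b * b' + c * a'"]) simp
qed

lemma quad_expansion_inverse:
  assumes e: "(e \<longlongrightarrow> 0) F" and u: "quad_expansion F e u a b" and "a \<noteq> 0"
  shows "quad_expansion F e (\<lambda>x. inverse (u x)) (inverse a) (- b / a ^ 2)"
proof -
  have u0: "(u \<longlongrightarrow> a) F" by (rule quad_expansion_tendsto[OF e u])
  obtain c where c: "(\<lambda>x. u x - (a + b * e x + c * e x ^ 2)) \<in> O[F](\<lambda>x. e x ^ 3)"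
    using u by (auto simp: quad_expansion_def)
  \<comment> \<open>\<open>m\<close> is the second Taylor coefficient of
    \<open>1 / (a + b * e + c * e ^ 2)\<close> at \<open>e = 0\<close>, so that \<open>d\<close> is
    an inverse of this polynomial up to \<open>e ^ 3 * r\<close>. The error \<open>1 / u - d\<close>
    is \<open>(1 - u * d) / u\<close>, and \<open>1 / u\<close> is bounded because \<open>a\<close>
    is nonzero.\<close>
  define m where "m = (b ^ 2 - a * c) / a ^ 3"
  define d where "d x = inverse a + (- b / a ^ 2) * e x + m * e x ^ 2" for x
  define r where "r x = (2 * b * c / a ^ 2 - b ^ 3 / a ^ 3) - c * m * e x" for x
  have "(d \<longlongrightarrow> inverse a + (- b / a ^ 2) * 0 + m * 0 ^ 2) F"
    "(r \<longlongrightarrow> (2 * b * c / a ^ 2 - b ^ 3 / a ^ 3) - c * m * 0) F"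
    unfolding d_def r_def by (intro tendsto_intros e)+
  then have d: "d \<in> O[F](\<lambda>_. 1)" and r: "r \<in> O[F](\<lambda>_. 1)"
    by (auto intro: tendsto_in_bigo_1)
  have i: "(\<lambda>x. inverse (u x)) \<in> O[F](\<lambda>_. 1)"
    by (rule tendsto_in_bigo_1[OF tendsto_inverse[OF u0 \<open>a \<noteq> 0\<close>]])
  have 1: "(\<lambda>x. (u x - (a + b * e x + c * e x ^ 2)) * d x) \<in> O[F](\<lambda>x. e x ^ 3 * 1)"
    by (intro landau_o.big.mult c d)
  have 2: "(\<lambda>x. e x ^ 3 * r x) \<in> O[F](\<lambda>x. e x ^ 3 * 1)"
    by (intro landau_o.big.mult r landau_o.big_refl)
  have "(\<lambda>x. (e x ^ 3 * r x - (u x - (a + b * e x + c * e x ^ 2)) * d x) * inverse (u x))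
          \<in> O[F](\<lambda>x. e x ^ 3 * 1)"
    using sum_in_bigo(2)[OF 2 1] by (intro landau_o.big.mult i) simp
  moreover have "eventually (\<lambda>x. (e x ^ 3 * r x - (u x - (a + b * e x + c * e x ^ 2)) * d x) * inverse (u x)
       = inverse (u x) - (inverse a + (- b / a ^ 2) * e x + m * e x ^ 2)) F"
    using tendsto_imp_eventually_ne[OF u0 \<open>a \<noteq> 0\<close>]
  proof eventually_elim
    case (elim x)
    have "e x ^ 3 * r x + (a + b * e x + c * e x ^ 2) * d x = 1"
      unfolding r_def d_def m_def using \<open>a \<noteq> 0\<close>
      by (simp add: divide_simps) algebra
    then have "e x ^ 3 * r x - (u x - (a + b * e x + c * e x ^ 2)) * d x = 1 - u x * d x"
      by (simp add: algebra_simps)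
    moreover have "(1 - u x * d x) * inverse (u x) = inverse (u x) - d x"
      using elim by (simp add: field_simps)
    ultimately show ?case by (simp only: d_def)
  qed
  ultimately have "(\<lambda>x. inverse (u x) - (inverse a + (- b / a ^ 2) * e x + m * e x ^ 2)) \<in> O[F](\<lambda>x. e x ^ 3 * 1)"
    by (rule landau_o.big.in_cong[THEN iffD1, rotated])
  then show ?thesis by (intro quad_expansionI[where c = m]) simp
qed

lemma quad_expansion_divide:
  assumes e: "(e \<longlongrightarrow> 0) F"
    and u: "quad_expansion F e u a b" and v: "quad_expansion F e v a' b'" and "a' \<noteq> 0"
  shows "quad_expansion F e (\<lambda>x. u x / v x) (a / a') ((b - a / a' * b') / a')"
  by (rule quad_expansion_cong[OF quad_expansion_mult[OF e u quad_expansion_inverse[OF e v \<open>a' \<noteq> 0\<close>]]])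
     (use \<open>a' \<noteq> 0\<close> in \<open>simp_all add: field_simps power2_eq_square\<close>)

text \<open>The inner expansion has no constant term, so \<open>u = O(e)\<close> and a cubic
  remainder in \<open>u\<close> is cubic in \<open>e\<close>. The filter \<open>G\<close> is left
  general because the outer function may be a quotient expanded on a punctured neighbourhood
  (\<open>at 0\<close>) or the weight function, expanded at \<open>nhds 0\<close>.\<close>

lemma quad_expansion_compose:
  assumes e: "(e \<longlongrightarrow> 0) F" and g: "quad_expansion G (\<lambda>t. t) g a a'"
    and u: "quad_expansion F e u 0 b" and G: "filterlim u G F"
  shows "quad_expansion F e (\<lambda>x. g (u x)) a (a' * b)"
proof -
  obtain c where c: "(\<lambda>t. g t - (a + a' * t + c * t ^ 2)) \<in> O[G](\<lambda>t. t ^ 3)"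
    using g by (auto simp: quad_expansion_def)
  have ue: "u \<in> O[F](e)"
  proof -
    obtain k where k: "(\<lambda>x. u x - (0 + b * e x + k * e x ^ 2)) \<in> O[F](\<lambda>x. e x ^ 3)"
      using u by (auto simp: quad_expansion_def)
    have "(\<lambda>x. u x - (0 + b * e x + k * e x ^ 2)) \<in> O[F](e)"
      using landau_o.big_trans[OF k power_in_bigo_power[OF e, of 1 3]] by simp
    moreover have "(\<lambda>x. 0 + b * e x + k * e x ^ 2) \<in> O[F](e)"
      using power_in_bigo_power[OF e, of 1 2] by (auto intro!: sum_in_bigo)
    ultimately have "(\<lambda>x. (u x - (0 + b * e x + k * e x ^ 2)) + (0 + b * e x + k * e x ^ 2)) \<in> O[F](e)"
      by (rule sum_in_bigo(1))
    then show ?thesis by simp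
  qed
  have "(\<lambda>x. g (u x) - (a + a' * u x + c * u x ^ 2)) \<in> O[F](\<lambda>x. u x ^ 3)"
    using landau_o.big.compose[OF c G] .
  then have r: "(\<lambda>x. g (u x) - (a + a' * u x + c * u x ^ 2)) \<in> O[F](\<lambda>x. e x ^ 3)"
    by (rule landau_o.big_trans[OF _ landau_o.big_power[OF ue]])
  have "quad_expansion F e
      (\<lambda>x. (g (u x) - (a + a' * u x + c * u x ^ 2)) + (a + a' * u x + c * (u x * u x)))
      (0 + (a + a' * 0 + c * (0 * 0))) (0 + (0 + (a' * b + 0 * 0) + (c * (0 * b + b * 0) + 0 * (0 * 0))))"
    by (intro quad_expansion_add quad_expansion_mult[OF e] quad_expansion_const u quad_expansion_bigo r)
  then show ?thesis
    by (rule quad_expansion_cong) (auto simp: power2_eq_square)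
qed

text \<open>Exchanging one factor at a time, the error is
  \<open>(u - a e^m) v + a e^m (v - b e^n)\<close>, where \<open>v = O(e^n)\<close>. This keeps the
  sharp order of a product whose factors both vanish in the limit, which multiplying second-order
  expansions would lose.\<close>

lemma bigo_leading_mult:
  fixes e :: "'a \<Rightarrow> real"
  assumes e: "(e \<longlongrightarrow> 0) F"
    and u: "(\<lambda>x. u x - a * e x ^ m) \<in> O[F](\<lambda>x. e x ^ Suc m)"
    and v: "(\<lambda>x. v x - b * e x ^ n) \<in> O[F](\<lambda>x. e x ^ Suc n)"
  shows "(\<lambda>x. u x * v x - a * b * e x ^ (m + n)) \<in> O[F](\<lambda>x. e x ^ Suc (m + n))"
proof -
  have "(\<lambda>x. v x - b * e x ^ n) \<in> O[F](\<lambda>x. e x ^ n)"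
    using landau_o.big_trans[OF v power_in_bigo_power[OF e, of n "Suc n"]] by simp
  then have v': "v \<in> O[F](\<lambda>x. e x ^ n)"
    using sum_in_bigo(1)[of "\<lambda>x. v x - b * e x ^ n" F "\<lambda>x. e x ^ n" "\<lambda>x. b * e x ^ n"] by simp
  have "(\<lambda>x. (u x - a * e x ^ m) * v x) \<in> O[F](\<lambda>x. e x ^ Suc m * e x ^ n)"
    by (intro landau_o.big.mult u v')
  moreover have "(\<lambda>x. (a * e x ^ m) * (v x - b * e x ^ n)) \<in> O[F](\<lambda>x. e x ^ m * e x ^ Suc n)"
    by (intro landau_o.big.mult v) simp
  ultimately have "(\<lambda>x. (u x - a * e x ^ m) * v x + (a * e x ^ m) * (v x - b * e x ^ n))
      \<in> O[F](\<lambda>x. e x ^ Suc (m + n))"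
    by (intro sum_in_bigo) (simp_all add: power_add algebra_simps)
  then show ?thesis by (simp add: power_add algebra_simps)
qed

section \<open>Smoothness and Taylor's formula\<close>

lemma cont_diff_on_DERIV:
  assumes "open S" "cont_diff_on k f S" "j < k" "x \<in> S"
  shows "((deriv ^^ j) f has_real_derivative (deriv ^^ Suc j) f x) (at x)"
proof -
  have "(deriv ^^ j) f differentiable (at x)"
    using assms by (auto simp: cont_diff_on_def differentiable_on_eq_differentiable_at)
  then show ?thesis
    by (auto simp: real_differentiable_def DERIV_imp_deriv)
qed

text \<open>This is the Lagrange form of the remainder; the intermediate point stays in a compact
  ball around \<open>a\<close>, on which the continuous \<open>n\<close>-th derivative is
  bounded.\<close>

lemma cont_diff_on_taylor:
  assumes "open S" "cont_diff_on n f S" "a \<in> S" "0 < n"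
  shows "(\<lambda>h. f (a + h) - (\<Sum>m<n. (deriv ^^ m) f a / fact m * h ^ m)) \<in> O[nhds 0](\<lambda>h. h ^ n)"
proof -
  obtain d where d: "d > 0" "cball a d \<subseteq> S"
    using assms open_contains_cball by blast
  have "continuous_on (cball a d) ((deriv ^^ n) f)"
    using assms d continuous_on_subset by (auto simp: cont_diff_on_def)
  then have "bounded ((deriv ^^ n) f ` cball a d)"
    by (intro compact_imp_bounded compact_continuous_image compact_cball)
  then obtain B where B: "\<bar>(deriv ^^ n) f x\<bar> \<le> B" if "x \<in> cball a d" for x
    unfolding bounded_iff by fastforce
  have "\<bar>f (a + h) - (\<Sum>m<n. (deriv ^^ m) f a / fact m * h ^ m)\<bar> \<le> \<bar>B\<bar> / fact n * \<bar>h\<bar> ^ n"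
    if h: "\<bar>h\<bar> < d" for h
  proof (cases "h = 0")
    case True
    have "(\<Sum>m<n. (deriv ^^ m) f a / fact m * 0 ^ m) = (\<Sum>m\<in>{0}. (deriv ^^ m) f a / fact m * 0 ^ m)"
      using \<open>0 < n\<close> by (intro sum.mono_neutral_right) auto
    then show ?thesis using True \<open>0 < n\<close> by simp
  next
    case False
    have "\<exists>t. (if a + h < a then a + h < t \<and> t < a else a < t \<and> t < a + h) \<and>
       f (a + h) = (\<Sum>m<n. (deriv ^^ m) f a / fact m * (a + h - a) ^ m)
          + (deriv ^^ n) f t / fact n * (a + h - a) ^ n"
    proof (rule Taylor[where a = "a - d" and b = "a + d" and diff = "\<lambda>m. (deriv ^^ m) f"])
      show "\<forall>m t. m < n \<and> a - d \<le> t \<and> t \<le> a + d \<longrightarrow>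
          ((deriv ^^ m) f has_real_derivative (deriv ^^ Suc m) f t) (at t)"
      proof (intro allI impI)
        fix m t assume "m < n \<and> a - d \<le> t \<and> t \<le> a + d"
        moreover from this have "t \<in> S"
          by (intro subsetD[OF d(2)]) (auto simp: dist_real_def)
        ultimately show "((deriv ^^ m) f has_real_derivative (deriv ^^ Suc m) f t) (at t)"
          by (intro cont_diff_on_DERIV[OF assms(1,2)]) auto
      qed
    qed (use h False d assms in auto)
    then obtain t where t: "if h < 0 then a + h < t \<and> t < a else a < t \<and> t < a + h"
      and eq: "f (a + h) = (\<Sum>m<n. (deriv ^^ m) f a / fact m * h ^ m) + (deriv ^^ n) f t / fact n * h ^ n"
      by auto
    have "t \<in> cball a d" using t h by (auto simp: dist_real_def split: if_splits)
    then have "\<bar>(deriv ^^ n) f t\<bar> \<le> \<bar>B\<bar>" using B by fastforce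
    then show ?thesis
      by (auto simp: eq abs_mult power_abs intro!: mult_right_mono divide_right_mono)
  qed
  moreover have "eventually (\<lambda>h. \<bar>h\<bar> < d) (nhds (0 :: real))"
    using d eventually_nhds_metric[of "\<lambda>h. \<bar>h\<bar> < d" 0] by auto
  ultimately show ?thesis
    by (intro bigoI[where c = "\<bar>B\<bar> / fact n"]) (auto elim!: eventually_mono simp: power_abs)
qed

lemma cont_diff_on_deriv:
  assumes "cont_diff_on (Suc k) f S"
  shows "cont_diff_on k (deriv f) S"
  unfolding cont_diff_on_def
proof (intro conjI allI impI)
  fix j assume "j < k"
  then have "(deriv ^^ Suc j) f differentiable_on S"
    using assms unfolding cont_diff_on_def by blast
  then show "(deriv ^^ j) (deriv f) differentiable_on S"
    by (simp add: funpow_Suc_right del: funpow.simps)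
next
  have "continuous_on S ((deriv ^^ Suc k) f)"
    using assms unfolding cont_diff_on_def by blast
  then show "continuous_on S ((deriv ^^ k) (deriv f))"
    by (simp add: funpow_Suc_right del: funpow.simps)
qed

section \<open>Local convergence as a consequence of the order\<close>

text \<open>Close to the root each step at least halves the error, so the iterates stay in the
  neighbourhood and converge geometrically. The hypothesis speaks of a punctured neighbourhood only;
  this suffices since a defined step has \<open>f x \<noteq> 0\<close>, so no iterate equals the
  root.\<close>

lemma locally_convergentI:
  assumes "f \<alpha> = 0"
    and "(\<lambda>x. scheme_step f A x - \<alpha>) \<in> o[at \<alpha> within {x. step_defined f A x}](\<lambda>x. x - \<alpha>)"
  shows "locally_convergent f A \<alpha>"
proof -
  have "eventually (\<lambda>x. norm (scheme_step f A x - \<alpha>) \<le> 1/2 * norm (x - \<alpha>))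
      (at \<alpha> within {x. step_defined f A x})"
    by (rule landau_o.smallD[OF assms(2)]) simp
  then obtain d where d: "d > 0" and step: "\<And>x. step_defined f A x \<Longrightarrow> x \<noteq> \<alpha> \<Longrightarrow> dist x \<alpha> < d
      \<Longrightarrow> \<bar>scheme_step f A x - \<alpha>\<bar> \<le> 1/2 * \<bar>x - \<alpha>\<bar>"
    by (auto simp: eventually_at)
  show ?thesis unfolding locally_convergent_def
  proof (intro exI[of _ d] conjI allI impI d)
    fix x :: "nat \<Rightarrow> real" assume x: "scheme_seq f A x \<and> \<bar>x 0 - \<alpha>\<bar> < d"
    then have defd: "step_defined f A (x n)" and step_eq: "x (Suc n) = scheme_step f A (x n)" for n
      by (auto simp: scheme_seq_def)
    have ne: "x n \<noteq> \<alpha>" for n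
      using defd[of n] assms(1) by (auto simp: step_defined_def)
    have bound: "\<bar>x n - \<alpha>\<bar> \<le> (1/2) ^ n * \<bar>x 0 - \<alpha>\<bar>" for n
    proof (induction n)
      case (Suc n)
      have "(1/2) ^ n * \<bar>x 0 - \<alpha>\<bar> \<le> 1 * \<bar>x 0 - \<alpha>\<bar>"
        by (intro mult_right_mono power_le_one) auto
      with Suc x have "dist (x n) \<alpha> < d" by (simp add: dist_real_def)
      from step[OF defd ne this] have "\<bar>x (Suc n) - \<alpha>\<bar> \<le> 1/2 * \<bar>x n - \<alpha>\<bar>" by (simp add: step_eq)
      with Suc show ?case by simp
    qed simp
    have "(\<lambda>n. (1/2) ^ n * \<bar>x 0 - \<alpha>\<bar>) \<longlonglongrightarrow> 0 * \<bar>x 0 - \<alpha>\<bar>"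
      by (intro tendsto_intros) auto
    then have "(\<lambda>n. (1/2) ^ n * \<bar>x 0 - \<alpha>\<bar>) \<longlonglongrightarrow> 0" by simp
    then have "(\<lambda>n. x n - \<alpha>) \<longlonglongrightarrow> 0"
      by (rule Lim_null_comparison[rotated]) (auto simp: bound)
    then show "x \<longlonglongrightarrow> \<alpha>" by (simp add: LIM_zero_iff)
  qed
qed

text \<open>For \<open>p \<ge> 2\<close> the leading term and the remainder are both
  \<open>O(e^2)\<close>, hence \<open>o(e)\<close>.\<close>

lemma order_at_least_imp_locally_convergent:
  assumes "f \<alpha> = 0" "order_at_least p f A \<alpha>" "2 \<le> p"
  shows "locally_convergent f A \<alpha>"
proof (rule locally_convergentI)
  show "f \<alpha> = 0" by fact
next
  let ?F = "at \<alpha> within {x. step_defined f A x}"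
  obtain K where K: "(\<lambda>x. (scheme_step f A x - \<alpha>) - K * (x - \<alpha>) ^ p) \<in> O[?F](\<lambda>x. (x - \<alpha>) ^ (p + 1))"
    using assms(2) by (auto simp: order_at_least_def)
  have e: "((\<lambda>x. x - \<alpha>) \<longlongrightarrow> 0) ?F" by (simp add: LIM_zero_iff)
  have p: "(\<lambda>x. (x - \<alpha>) ^ p) \<in> O[?F](\<lambda>x. (x - \<alpha>) ^ 2)" 
    "(\<lambda>x. (x - \<alpha>) ^ (p + 1)) \<in> O[?F](\<lambda>x. (x - \<alpha>) ^ 2)"
    by (rule power_in_bigo_power[OF e]; use assms in simp)+
  have "(\<lambda>x. ((scheme_step f A x - \<alpha>) - K * (x - \<alpha>) ^ p) + K * (x - \<alpha>) ^ p) \<in> O[?F](\<lambda>x. (x - \<alpha>) ^ 2)"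
    using landau_o.big_trans[OF K p(2)] p(1) by (intro sum_in_bigo(1)) simp_all
  moreover have "(\<lambda>x. (x - \<alpha>) ^ 2) \<in> o[?F](\<lambda>x. x - \<alpha>)"
  proof -
    have "(\<lambda>x. (x - \<alpha>) * (x - \<alpha>)) \<in> o[?F](\<lambda>x. 1 * (x - \<alpha>))"
      using e by (intro landau_o.small_big_mult) (simp_all add: smallo_1_iff_tendsto)
    then show ?thesis by (simp add: power2_eq_square)
  qed
  ultimately show "(\<lambda>x. scheme_step f A x - \<alpha>) \<in> o[?F](\<lambda>x. x - \<alpha>)"
    using landau_o.big_small_trans by auto
qed

section \<open>Divided differences of a Taylor remainder\<close>

text \<open>If \<open>u x = v x\<close>, the divided difference is \<open>0 / 0 = 0\<close>, so no distinctness is needed.\<close>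
lemma div_diff_in_bigo:
  fixes R R' :: "real \<Rightarrow> real"
  assumes der: "eventually (\<lambda>h. (R has_field_derivative R' h) (at h)) (nhds 0)"
    and R': "R' \<in> O[nhds 0](\<lambda>h. h ^ n)"
    and uv: "(u \<longlongrightarrow> 0) F" "(v \<longlongrightarrow> 0) F"
    and uvg: "u \<in> O[F](g)" "v \<in> O[F](g)"
  shows "(\<lambda>x. div_diff R (u x) (v x)) \<in> O[F](\<lambda>x. g x ^ n)"
proof -
  obtain C where "C > 0" and C: "eventually (\<lambda>h. norm (R' h) \<le> C * norm (h ^ n)) (nhds 0)"
    using R' by (auto elim: landau_o.bigE)
  obtain d where d: "d > 0" and dd: "\<And>h. \<bar>h\<bar> < d \<Longrightarrow> (R has_field_derivative R' h) (at h)"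
    "\<And>h. \<bar>h\<bar> < d \<Longrightarrow> \<bar>R' h\<bar> \<le> C * \<bar>h\<bar> ^ n"
    using eventually_conj[OF der C] by (auto simp: eventually_nhds_metric power_abs)
  have bound: "\<bar>div_diff R a b\<bar> \<le> C * (\<bar>a\<bar> + \<bar>b\<bar>) ^ n" if "\<bar>a\<bar> < d" "\<bar>b\<bar> < d" for a b
  proof -
    \<comment> \<open>Both nodes lie in the ball of radius \<open>m\<close> around 0, which is
      convex, so the bound of the derivative there carries over to the difference quotient. No lower
      bound on the distance of the nodes enters.\<close>
    define m where "m = max \<bar>a\<bar> \<bar>b\<bar>"
    have "norm (R a - R b) \<le> (C * m ^ n) * norm (a - b)"
    proof (rule field_differentiable_bound[where S = "cball 0 m"])
      fix z :: real assume z: "z \<in> cball 0 m"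
      then have "\<bar>z\<bar> \<le> m" by simp
      moreover have "m < d" using that by (simp add: m_def)
      ultimately have zd: "\<bar>z\<bar> < d" by simp
      then show "(R has_field_derivative R' z) (at z within cball 0 m)"
        by (intro DERIV_subset[OF dd(1)]) auto
      have "C * \<bar>z\<bar> ^ n \<le> C * m ^ n"
        using \<open>C > 0\<close> \<open>\<bar>z\<bar> \<le> m\<close> by (intro mult_left_mono power_mono) auto
      then show "norm (R' z) \<le> C * m ^ n" using dd(2)[OF zd] by simp
    qed (auto simp: m_def)
    then have "\<bar>div_diff R a b\<bar> \<le> C * m ^ n"
      using \<open>C > 0\<close> by (cases "a = b") (auto simp: div_diff_def m_def divide_simps)
    also have "\<dots> \<le> C * (\<bar>a\<bar> + \<bar>b\<bar>) ^ n"
      using \<open>C > 0\<close> by (intro mult_left_mono power_mono) (auto simp: m_def)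
    finally show ?thesis .
  qed
  have "eventually (\<lambda>x. \<bar>u x\<bar> < d) F" "eventually (\<lambda>x. \<bar>v x\<bar> < d) F"
    using uv d by (auto simp: tendsto_iff dist_real_def)
  then have "eventually (\<lambda>x. norm (div_diff R (u x) (v x)) \<le> C * norm ((\<bar>u x\<bar> + \<bar>v x\<bar>) ^ n)) F"
    by eventually_elim (use bound in simp)
  then have "(\<lambda>x. div_diff R (u x) (v x)) \<in> O[F](\<lambda>x. (\<bar>u x\<bar> + \<bar>v x\<bar>) ^ n)"
    by (rule bigoI)
  moreover have "(\<lambda>x. \<bar>u x\<bar> + \<bar>v x\<bar>) \<in> O[F](g)"
    using uvg by (intro sum_in_bigo(1)) simp_all
  ultimately show ?thesis
    by (rule landau_o.big_trans[OF _ landau_o.big_power])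
qed

section \<open>The error of one step of the scheme\<close>

text \<open>Both claims about the order are read off from this factorization, since
  \<open>a1\<close> can cancel the linear coefficient of \<open>w\<close>. The constants
  \<open>f1\<close> to \<open>f4\<close> are the Taylor coefficients of \<open>f\<close> at the
  root. The expansion is required of the derivative because the mean value theorem bounds divided
  differences of the remainder \<open>R\<close> by its derivative; that \<open>R\<close> is
  \<open>O(h^5)\<close> then follows from \<open>R 0 = 0\<close>.\<close>

lemma scheme_step_factorization:
  fixes f A :: "real \<Rightarrow> real" and \<alpha> f1 f2 f3 f4 a1 :: real
  assumes f0: "f \<alpha> = 0" and f1: "f1 \<noteq> 0"
    and diff: "eventually (\<lambda>h. f differentiable (at (\<alpha> + h))) (nhds 0)"
    and taylor: "(\<lambda>h. deriv f (\<alpha> + h) - (f1 + 2 * f2 * h + 3 * f3 * h ^ 2 + 4 * f4 * h ^ 3))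
                   \<in> O[nhds 0](\<lambda>h. h ^ 4)"
    and A: "quad_expansion (nhds 0) (\<lambda>t. t) A 1 a1"
  obtains w s b where
    "quad_expansion (at \<alpha> within {x. step_defined f A x}) (\<lambda>x. x - \<alpha>) w 0 ((2 - a1) * (f2 / f1) ^ 2)"
    "quad_expansion (at \<alpha> within {x. step_defined f A x}) (\<lambda>x. x - \<alpha>) s 0 b"
    "(\<lambda>x. (scheme_step f A x - \<alpha>) - (x - \<alpha>) ^ 4 * (w x * s x))
       \<in> O[at \<alpha> within {x. step_defined f A x}](\<lambda>x. (x - \<alpha>) ^ 8)"
proof -
  \<comment> \<open>This filter may be trivial: if \<open>f\<close> is affine near the root,
    Newton's step hits the root and no step is defined there. The asymptotic statements then hold
    vacuously.\<close>
  define F where "F = at \<alpha> within {x. step_defined f A x}"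
  define e where "e = (\<lambda>x. x - \<alpha>)"
  have xe: "\<alpha> + e x = x" for x by (simp add: e_def)
  have e: "(e \<longlongrightarrow> 0) F" by (simp add: e_def F_def LIM_zero_iff)
  have ne: "eventually (\<lambda>x. e x \<noteq> 0) F"
    by (simp add: e_def F_def eventually_at_filter)
  have e_at: "filterlim e (at 0) F" using e ne by (simp add: filterlim_at)
  have sd: "eventually (step_defined f A) F"
    by (simp add: F_def eventually_at_filter)
  \<comment> \<open>For the polynomial part \<open>P\<close> all divided differences are computed
    exactly by algebra; only \<open>R\<close> needs estimates.\<close>
  define P where "P h = f1 * h + f2 * h ^ 2 + f3 * h ^ 3 + f4 * h ^ 4" for h
  define P' where "P' h = f1 + 2 * f2 * h + 3 * f3 * h ^ 2 + 4 * f4 * h ^ 3" for h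
  define R where "R h = f (\<alpha> + h) - P h" for h
  define R' where "R' h = deriv f (\<alpha> + h) - P' h" for h
  have fR: "f (\<alpha> + h) = P h + R h" and fR': "deriv f (\<alpha> + h) = P' h + R' h" for h
    by (simp_all add: R_def R'_def)
  have der: "eventually (\<lambda>h. (R has_field_derivative R' h) (at h)) (nhds 0)"
    using diff
  proof eventually_elim
    case (elim h)
    then have "(f has_field_derivative deriv f (h + \<alpha>)) (at (h + \<alpha>))"
      by (auto simp: real_differentiable_def DERIV_imp_deriv add.commute)
    then have "((\<lambda>h. f (h + \<alpha>)) has_field_derivative deriv f (h + \<alpha>)) (at h)"
      by (simp only: DERIV_shift)
    then have "((\<lambda>h. f (\<alpha> + h)) has_field_derivative deriv f (\<alpha> + h)) (at h)"
      by (simp add: add.commute)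
    then show ?case
      unfolding R_def R'_def P_def P'_def by (auto intro!: derivative_eq_intros)
  qed
  have R': "R' \<in> O[nhds 0](\<lambda>h. h ^ 4)" using taylor by (simp add: R'_def[abs_def] P'_def)
  have "R 0 = 0" by (simp add: R_def P_def f0)
  then have R_dd: "R h = div_diff R h 0 * h" for h by (simp add: div_diff_def)
  have R_comp: "(\<lambda>x. R (u x)) \<in> O[H](\<lambda>x. g x ^ 5)" if u: "(u \<longlongrightarrow> 0) H" "u \<in> O[H](g)"
    for u g :: "real \<Rightarrow> real" and H
  proof -
    have "(\<lambda>x. div_diff R (u x) 0 * u x) \<in> O[H](\<lambda>x. g x ^ 4 * g x)"
      by (intro landau_o.big.mult u div_diff_in_bigo[OF der R']) simp_all
    then show ?thesis using R_dd by (simp add: power_numeral_reduce mult_ac)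
  qed

  note quad_intros = quad_expansion_add quad_expansion_diff quad_expansion_mult[OF e]
    quad_expansion_divide[OF e] quad_expansion_const quad_expansion_base

  have G: "quad_expansion (at 0) (\<lambda>h. h) (\<lambda>h. f (\<alpha> + h) / h) f1 f2"
  proof (rule quad_expansionI[where c = f3])
    have ne0: "eventually (\<lambda>h. h \<noteq> (0 :: real)) (at 0)" by (simp add: eventually_at_filter)
    have "R \<in> O[at 0](\<lambda>h. h ^ 5)" using R_comp[of "\<lambda>h. h" "at 0" "\<lambda>h. h"] by simp
    then have "(\<lambda>h. R h / h ^ 1) \<in> O[at 0](\<lambda>h. h ^ 4)"
      by (intro bigo_divide_power ne0) simp
    then have "(\<lambda>h. R h / h ^ 1) \<in> O[at 0](\<lambda>h. h ^ 3)"
      using landau_o.big_trans power_in_bigo_power[OF tendsto_ident_at, of 3 4] by fastforce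
    then have "(\<lambda>h. f4 * h ^ 3 + R h / h ^ 1) \<in> O[at 0](\<lambda>h. h ^ 3)"
      by (intro sum_in_bigo(1)) simp_all
    moreover have "eventually (\<lambda>h. f4 * h ^ 3 + R h / h ^ 1 = f (\<alpha> + h) / h - (f1 + f2 * h + f3 * h ^ 2)) (at 0)"
      using ne0 by eventually_elim (unfold fR P_def, simp add: field_simps power_numeral_reduce)
    ultimately show "(\<lambda>h. f (\<alpha> + h) / h - (f1 + f2 * h + f3 * h ^ 2)) \<in> O[at 0](\<lambda>h. h ^ 3)"
      by (rule landau_o.big.in_cong[THEN iffD1, rotated])
  qed

  have fe: "quad_expansion F e (\<lambda>x. f x / e x) f1 f2"
    using quad_expansion_compose[OF e G quad_expansion_base e_at] by (simp add: xe)

  have R'e: "(\<lambda>x. R' (e x)) \<in> O[F](\<lambda>x. e x ^ 4)" using landau_o.big.compose[OF R' e] .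
  have Re: "(\<lambda>x. R (e x)) \<in> O[F](\<lambda>x. e x ^ 5)" by (rule R_comp[OF e]) simp

  have f': "quad_expansion F e (deriv f) f1 (2 * f2)"
  proof (rule quad_expansionI[where c = "3 * f3"])
    have "(\<lambda>x. 4 * f4 * e x ^ 3 + R' (e x)) \<in> O[F](\<lambda>x. e x ^ 3)"
      using landau_o.big_trans[OF R'e power_in_bigo_power[OF e]] by (intro sum_in_bigo(1)) simp_all
    moreover have "4 * f4 * e x ^ 3 + R' (e x) = deriv f x - (f1 + 2 * f2 * e x + 3 * f3 * e x ^ 2)" for x
      using fR'[of "e x"] by (simp add: xe P'_def)
    ultimately show "(\<lambda>x. deriv f x - (f1 + 2 * f2 * e x + 3 * f3 * e x ^ 2)) \<in> O[F](\<lambda>x. e x ^ 3)"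
      by simp
  qed

  \<comment> \<open>Newton's error is this numerator times \<open>e^2\<close>, divided by
    \<open>f'(x)\<close>. In \<open>e f'(x) - f(x)\<close> the coefficient of \<open>e^k\<close> is
    \<open>(k - 1)\<close> times that of \<open>f\<close>: the linear term cancels, leaving
    \<open>f2\<close>, \<open>2 * f3\<close> and \<open>3 * f4\<close>.\<close>
  have N: "quad_expansion F e (\<lambda>x. (e x * deriv f x - f x) / e x ^ 2) f2 (2 * f3)"
  proof (rule quad_expansionI[where c = "3 * f4"])
    have "(\<lambda>x. e x * R' (e x)) \<in> O[F](\<lambda>x. e x * e x ^ 4)"
      by (intro landau_o.big.mult R'e) simp
    then have "(\<lambda>x. e x * R' (e x) - R (e x)) \<in> O[F](\<lambda>x. e x ^ 5)"
      using Re by (intro sum_in_bigo(2)) (simp_all add: power_numeral_reduce)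
    then have "(\<lambda>x. (e x * R' (e x) - R (e x)) / e x ^ 2) \<in> O[F](\<lambda>x. e x ^ 3)"
      by (intro bigo_divide_power ne) simp
    moreover have "eventually (\<lambda>x. (e x * R' (e x) - R (e x)) / e x ^ 2 =
        (e x * deriv f x - f x) / e x ^ 2 - (f2 + 2 * f3 * e x + 3 * f4 * e x ^ 2)) F"
      using ne
    proof eventually_elim
      case (elim x)
      have "f x = P (e x) + R (e x)" "deriv f x = P' (e x) + R' (e x)"
        using fR[of "e x"] fR'[of "e x"] by (simp_all add: xe)
      with elim show ?case
        by (simp add: P_def P'_def field_simps power_numeral_reduce)
    qed
    ultimately show "(\<lambda>x. (e x * deriv f x - f x) / e x ^ 2 - (f2 + 2 * f3 * e x + 3 * f4 * e x ^ 2))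
        \<in> O[F](\<lambda>x. e x ^ 3)"
      by (rule landau_o.big.in_cong[THEN iffD1, rotated])
  qed

  \<comment> \<open>\<open>q0\<close> is the constant
    \<open>f''(\<alpha>) / (2 f'(\<alpha>))\<close> in Newton's error.\<close>
  define q0 where "q0 = f2 / f1"
  define q where "q x = (e x * deriv f x - f x) / e x ^ 2 / deriv f x" for x
  obtain q1 where q: "quad_expansion F e q q0 q1"
    using quad_expansion_divide[OF e N f' f1] unfolding q_def[abs_def, symmetric] q0_def by blast
  define Y where "Y x = newton_pt f x - \<alpha>" for x
  have Yq: "eventually (\<lambda>x. Y x = e x * e x * q x) F"
    using sd ne
  proof eventually_elim
    case (elim x)
    then have "deriv f x \<noteq> 0" by (simp add: step_defined_def)
    moreover have "Y x = e x - f x / deriv f x" by (simp add: Y_def newton_pt_def e_def)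
    moreover have "e x * e x * q x = (e x * deriv f x - f x) / deriv f x"
      using elim(2) by (simp add: q_def power2_eq_square)
    ultimately show ?case by (simp add: diff_divide_distrib)
  qed
  \<comment> \<open>Here and below, \<open>quad_expansion_eq\<close> first makes the coefficients
    schematic, so that the rules compute them; the simplifier then compares them with the claimed
    ones.\<close>
  have "quad_expansion F e (\<lambda>x. e x * e x * q x) 0 0"
    by (rule quad_expansion_eq, (rule quad_intros q)+) simp_all
  then have Y: "quad_expansion F e Y 0 0"
    by (rule quad_expansion_cong) (use Yq in \<open>auto elim: eventually_mono\<close>)
  have Y0: "(Y \<longlongrightarrow> 0) F" by (rule quad_expansion_tendsto[OF e Y])
  have Yne: "eventually (\<lambda>x. Y x \<noteq> 0) F"
    using sd
  proof eventually_elim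
    case (elim x)
    show ?case
    proof
      assume "Y x = 0"
      then have "f (newton_pt f x) = 0" using f0 by (simp add: Y_def)
      then show False using elim by (simp add: step_defined_def weighted_pt_def)
    qed
  qed
  have Y_at: "filterlim Y (at 0) F" using Y0 Yne by (simp add: filterlim_at)
  define g where "g x = f (\<alpha> + Y x) / Y x" for x
  have g: "quad_expansion F e g f1 0"
    using quad_expansion_compose[OF e G Y Y_at] by (simp add: g_def[abs_def])
  have fY: "eventually (\<lambda>x. f (newton_pt f x) = Y x * g x) F"
    using Yne by eventually_elim (simp add: g_def Y_def)

  \<comment> \<open>The argument \<open>f(y) / f(x)\<close> is \<open>e^2 q g / f(x)\<close>; one
    factor \<open>e\<close> is moved below \<open>f(x)\<close> so that the denominator tends to
    \<open>f1\<close>.\<close>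
  have "quad_expansion F e (\<lambda>x. e x * q x * g x / (f x / e x)) 0 q0"
    by (rule quad_expansion_eq, (rule quad_intros q g fe f1)+) (simp_all add: f1)
  then have t: "quad_expansion F e (weight_arg f) 0 q0"
  proof (rule quad_expansion_cong)
    show "eventually (\<lambda>x. e x * q x * g x / (f x / e x) = weight_arg f x) F"
      using Yq fY ne by eventually_elim (simp add: weight_arg_def)
  qed auto
  have t0: "filterlim (weight_arg f) (nhds 0) F" by (rule quad_expansion_tendsto[OF e t])
  have At: "quad_expansion F e (\<lambda>x. A (weight_arg f x)) 1 (a1 * q0)"
    by (rule quad_expansion_compose[OF e A t t0])

  \<comment> \<open>\<open>v\<close> is the factor in \<open>Z = Y v\<close>. Its constant term
    vanishes because \<open>A\<close> takes the value 1 at 0. In its linear term,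
    \<open>2 * q0\<close> stems from \<open>f'(x)\<close> and \<open>a1 * q0\<close> from the
    weight.\<close>
  define v where "v x = 1 - A (weight_arg f x) * g x / deriv f x" for x
  have v: "quad_expansion F e v 0 ((2 - a1) * q0)"
    unfolding v_def
    by (rule quad_expansion_eq, (rule quad_intros At g f' f1)+) (simp_all add: f1 q0_def field_simps)
  define w where "w x = q x * v x" for x
  define w1 where "w1 = (2 - a1) * q0 ^ 2"
  have w: "quad_expansion F e w 0 w1"
    unfolding w_def w1_def
    by (rule quad_expansion_eq, (rule quad_intros q v)+) (simp_all add: power2_eq_square)
  define Z where "Z x = weighted_pt f A x - \<alpha>" for x
  have Zw: "eventually (\<lambda>x. Z x = e x * e x * w x) F"
    using Yq fY
  proof eventually_elim
    case (elim x)
    have "Z x = Y x - A (weight_arg f x) * (Y x * g x / deriv f x)"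
      by (simp add: Z_def weighted_pt_def elim(2)) (simp add: Y_def)
    then have "Z x = Y x * v x" by (simp add: v_def algebra_simps)
    then show ?case by (simp add: w_def elim(1))
  qed
  have "quad_expansion F e (\<lambda>x. e x * e x * w x) 0 0"
    by (rule quad_expansion_eq, (rule quad_intros w)+) simp_all
  then have Z: "quad_expansion F e Z 0 0"
    by (rule quad_expansion_cong) (use Zw in \<open>auto elim: eventually_mono\<close>)
  have Z0: "(Z \<longlongrightarrow> 0) F" by (rule quad_expansion_tendsto[OF e Z])
  have Y2: "Y \<in> O[F](\<lambda>x. e x ^ 2)" using quad_expansion_linear[OF e Y] by simp
  have Z2: "Z \<in> O[F](\<lambda>x. e x ^ 2)" using quad_expansion_linear[OF e Z] by simp
  have Z1: "Z \<in> O[F](e)"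
    using landau_o.big_trans[OF Z2 power_in_bigo_power[OF e, of 1 2]] by simp

  \<comment> \<open>The distance \<open>z - y\<close> has no known lower bound, but both nodes are
    \<open>O(e^2)\<close>, and the mean value estimate gives \<open>O(e^8)\<close> directly.\<close>
  define r1 where "r1 x = div_diff R (Z x) (Y x)" for x
  have "r1 \<in> O[F](\<lambda>x. (e x ^ 2) ^ 4)"
    unfolding r1_def by (rule div_diff_in_bigo[OF der R' Z0 Y0 Z2 Y2])
  then have "(\<lambda>x. r1 x / e x ^ 2) \<in> O[F](\<lambda>x. e x ^ 6)"
    by (intro bigo_divide_power ne) (simp flip: power_mult)
  then have r1: "quad_expansion F e (\<lambda>x. r1 x / e x ^ 2) 0 0"
    using landau_o.big_trans[OF _ power_in_bigo_power[OF e, of 3 6]] by (intro quad_expansion_bigo) simp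

  \<comment> \<open>The distance \<open>z - x\<close> is of exact order \<open>e\<close>, so
    dividing the remainder by it costs just one power of \<open>e\<close>.\<close>
  define r2 where "r2 x = (div_diff R (Z x) (e x) - R' (e x)) / e x ^ 1" for x
  have "(\<lambda>x. div_diff R (Z x) (e x) - R' (e x)) \<in> O[F](\<lambda>x. e x ^ 4)"
    by (intro sum_in_bigo(2) R'e div_diff_in_bigo[OF der R' Z0 e Z1]) simp
  then have "r2 \<in> O[F](\<lambda>x. e x ^ 3)"
    unfolding r2_def by (intro bigo_divide_power ne) simp
  then have r2: "quad_expansion F e r2 0 0" by (rule quad_expansion_bigo)
  \<comment> \<open>The polynomial terms are the divided difference of \<open>P\<close> with double
    node \<open>e\<close>. The last term is the share of \<open>R\<close>, namely
    \<open>e r2 / (Z - e)\<close> with \<open>Z - e = e (e w - 1)\<close>.\<close>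
  define dd where "dd x = f2 + f3 * (Z x + 2 * e x) + f4 * (Z x * Z x + 2 * Z x * e x + 3 * (e x * e x))
      + r2 x / (e x * w x - 1)" for x
  \<comment> \<open>This is the constant term of the denominator \<open>e x * w x - 1\<close> in the
    literal form that the rules produce.\<close>
  have "(0 * 0 - 1 :: real) \<noteq> 0" by simp
  have dd: "quad_expansion F e dd f2 (2 * f3)"
    unfolding dd_def
    by (rule quad_expansion_eq, (rule quad_intros Z w r2 \<open>(0 * 0 - 1 :: real) \<noteq> 0\<close>)+) simp_all
  have dd_eq: "eventually (\<lambda>x. div_diff_double f (weighted_pt f A x) x = dd x) F"
    using sd ne Zw
  proof eventually_elim
    case (elim x)
    have zne: "Z x - e x \<noteq> 0" using elim(1) by (simp add: step_defined_def Z_def e_def)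
    have fac: "Z x - e x = e x * (e x * w x - 1)" using elim by (simp add: algebra_simps)
    have "P (Z x) - P (e x) = (Z x - e x) * (P' (e x) + (Z x - e x) *
        (f2 + f3 * (Z x + 2 * e x) + f4 * (Z x * Z x + 2 * Z x * e x + 3 * (e x * e x))))"
      unfolding P_def P'_def by algebra
    then have P: "(P (Z x) - P (e x)) / (Z x - e x) - P' (e x) = (Z x - e x) *
        (f2 + f3 * (Z x + 2 * e x) + f4 * (Z x * Z x + 2 * Z x * e x + 3 * (e x * e x)))"
      using zne by simp
    have "div_diff f (weighted_pt f A x) x = (f (\<alpha> + Z x) - f (\<alpha> + e x)) / (Z x - e x)"
      by (simp add: div_diff_def Z_def e_def)
    also have "\<dots> = (P (Z x) - P (e x)) / (Z x - e x) + div_diff R (Z x) (e x)"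
      unfolding fR div_diff_def by (simp add: diff_divide_distrib add_divide_distrib)
    finally have "div_diff f (weighted_pt f A x) x - deriv f x =
        ((P (Z x) - P (e x)) / (Z x - e x) - P' (e x)) + e x * r2 x"
      using fR'[of "e x"] elim(2) by (simp add: xe r2_def)
    then have "div_diff_double f (weighted_pt f A x) x =
        (((P (Z x) - P (e x)) / (Z x - e x) - P' (e x)) + e x * r2 x) / (Z x - e x)"
      by (simp add: div_diff_double_def Z_def e_def)
    also have "\<dots> = f2 + f3 * (Z x + 2 * e x) + f4 * (Z x * Z x + 2 * Z x * e x + 3 * (e x * e x))
        + e x * r2 x / (Z x - e x)"
      unfolding P add_divide_distrib using zne by simp
    also have "\<dots> = dd x"
      unfolding fac dd_def using elim(2) by simp
    finally show ?case .
  qed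

  \<comment> \<open>\<open>e^2 s0\<close> is the slope approximation minus \<open>P(Z) / Z\<close>,
    using \<open>Y = e^2 q\<close> and \<open>Z - Y = e^2 (w - q)\<close>. Its constant term is
    \<open>q0 * f2 - q0 * f2 = 0\<close>: the correction by \<open>f[z,x,x]\<close> cancels the
    leading error of \<open>f[z,y]\<close>. In the linear term \<open>b\<close> the coefficient
    \<open>q1\<close> cancels too.\<close>
  define s0 where "s0 x = q x * (f2 + f3 * (Z x + Y x) + f4 * (Z x * Z x + Z x * Y x + Y x * Y x))
      + r1 x / e x ^ 2 + (w x - q x) * dd x" for x
  define b where "b = f2 * w1 - 2 * q0 * f3"
  have s0: "quad_expansion F e s0 0 b"
    unfolding s0_def b_def
    by (rule quad_expansion_eq, (rule quad_intros Z Y q w r1 dd)+) (simp_all add: algebra_simps)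
  define S where "S x = f1 + f2 * Z x + f3 * (Z x * Z x) + f4 * (Z x * Z x * Z x) + e x * e x * s0 x" for x
  have S: "quad_expansion F e S f1 0"
    unfolding S_def by (rule quad_expansion_eq, (rule quad_intros Z s0)+) simp_all
  have S_eq: "eventually (\<lambda>x. slope_approx f A x = S x) F"
    using sd ne Zw Yq dd_eq
  proof eventually_elim
    case (elim x)
    have zne: "Z x - Y x \<noteq> 0" using elim(1) by (simp add: step_defined_def Z_def Y_def)
    have "P (Z x) - P (Y x) = (Z x - Y x) * (f1 + f2 * Z x + f3 * (Z x * Z x) + f4 * (Z x * Z x * Z x)
        + Y x * (f2 + f3 * (Z x + Y x) + f4 * (Z x * Z x + Z x * Y x + Y x * Y x)))"
      unfolding P_def by algebra
    then have P: "(P (Z x) - P (Y x)) / (Z x - Y x)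
        = f1 + f2 * Z x + f3 * (Z x * Z x) + f4 * (Z x * Z x * Z x)
        + Y x * (f2 + f3 * (Z x + Y x) + f4 * (Z x * Z x + Z x * Y x + Y x * Y x))"
      using zne by simp
    have "div_diff f (weighted_pt f A x) (newton_pt f x) = (f (\<alpha> + Z x) - f (\<alpha> + Y x)) / (Z x - Y x)"
      by (simp add: div_diff_def Z_def Y_def)
    also have "\<dots> = (P (Z x) - P (Y x)) / (Z x - Y x) + r1 x"
      unfolding fR div_diff_def r1_def by (simp add: diff_divide_distrib add_divide_distrib)
    finally have "slope_approx f A x = (P (Z x) - P (Y x)) / (Z x - Y x) + r1 x + dd x * (Z x - Y x)"
      by (simp add: slope_approx_def elim(5)) (simp add: Z_def Y_def)
    moreover have "r1 x = e x * e x * (r1 x / e x ^ 2)" using elim(2) by (simp add: power2_eq_square)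
    moreover have "dd x * (Z x - Y x) = e x * e x * ((w x - q x) * dd x)"
      unfolding elim(3,4) by algebra
    ultimately have "slope_approx f A x = f1 + f2 * Z x + f3 * (Z x * Z x) + f4 * (Z x * Z x * Z x)
        + e x * e x * q x * (f2 + f3 * (Z x + Y x) + f4 * (Z x * Z x + Z x * Y x + Y x * Y x))
        + e x * e x * (r1 x / e x ^ 2) + e x * e x * ((w x - q x) * dd x)"
      using P elim(4) by simp
    then show ?case
      unfolding S_def s0_def by (simp only: distrib_left mult.assoc add.assoc)
  qed

  define s where "s x = s0 x / S x" for x
  have s: "quad_expansion F e s 0 (b / f1)"
    unfolding s_def by (rule quad_expansion_eq, (rule quad_intros s0 S f1)+) (simp_all add: f1)
  \<comment> \<open>This is in fact \<open>O(e^10)\<close>; the eighth power is enough for both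
    orders.\<close>
  have "(\<lambda>x. R (Z x)) \<in> O[F](\<lambda>x. (e x ^ 2) ^ 5)" by (rule R_comp[OF Z0 Z2])
  then have "(\<lambda>x. R (Z x)) \<in> O[F](\<lambda>x. e x ^ 8)"
    using landau_o.big_trans[OF _ power_in_bigo_power[OF e, of 8 10]] by (simp flip: power_mult)
  moreover have "(\<lambda>x. 1 / S x) \<in> O[F](\<lambda>_. 1)"
    by (rule quad_expansion_bounded[OF e quad_expansion_divide[OF e quad_expansion_const S f1]])
  ultimately have "(\<lambda>x. - (R (Z x) * (1 / S x))) \<in> O[F](\<lambda>x. e x ^ 8 * 1)"
    by (simp only: landau_o.big.uminus_in_iff) (rule landau_o.big.mult)
  moreover have "eventually (\<lambda>x. - (R (Z x) * (1 / S x)) = (scheme_step f A x - \<alpha>) - e x ^ 4 * (w x * s x)) F"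
    using sd S_eq Zw
  proof eventually_elim
    case (elim x)
    have Sne: "S x \<noteq> 0" using elim by (simp add: step_defined_def)
    have "f (weighted_pt f A x) = P (Z x) + R (Z x)" using fR[of "Z x"] by (simp add: Z_def)
    then have "scheme_step f A x - \<alpha> = Z x - (P (Z x) + R (Z x)) / S x"
      by (simp add: scheme_step_def elim(2)) (simp add: Z_def)
    also have "\<dots> = (Z x * S x - P (Z x)) / S x - R (Z x) / S x"
      using Sne by (simp add: field_simps)
    also have "Z x * S x - P (Z x) = Z x * (e x * e x * s0 x)"
      unfolding S_def P_def by algebra
    also have "\<dots> = e x ^ 4 * (w x * s0 x)" unfolding elim(3) by algebra
    finally show ?case by (simp add: s_def)
  qed
  ultimately have "(\<lambda>x. (scheme_step f A x - \<alpha>) - e x ^ 4 * (w x * s x)) \<in> O[F](\<lambda>x. e x ^ 8 * 1)"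
    by (rule landau_o.big.in_cong[THEN iffD1, rotated])
  then show ?thesis
    using that[OF w[unfolded e_def F_def w1_def q0_def] s[unfolded e_def F_def]]
    by (simp add: e_def F_def)
qed

section \<open>From the factorization to orders six and seven\<close>

text \<open>The exponent \<open>m + 5\<close> collects \<open>e^4\<close>, the order
  \<open>m\<close> of \<open>w\<close> and the order one of \<open>s\<close>. The remainder
  \<open>O(e^8)\<close> is absorbed in \<open>O(e^(m+6))\<close> as long as
  \<open>m \<le> 2\<close>.\<close>

lemma order_at_leastI:
  assumes w: "(\<lambda>x. w x - a * (x - \<alpha>) ^ m) \<in> O[at \<alpha> within {x. step_defined f A x}](\<lambda>x. (x - \<alpha>) ^ Suc m)"
    and s: "quad_expansion (at \<alpha> within {x. step_defined f A x}) (\<lambda>x. x - \<alpha>) s 0 b"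
    and st: "(\<lambda>x. (scheme_step f A x - \<alpha>) - (x - \<alpha>) ^ 4 * (w x * s x))
       \<in> O[at \<alpha> within {x. step_defined f A x}](\<lambda>x. (x - \<alpha>) ^ 8)"
    and "m \<le> 2"
  shows "order_at_least (m + 5) f A \<alpha>"
proof -
  let ?F = "at \<alpha> within {x. step_defined f A x}"
  have e: "((\<lambda>x. x - \<alpha>) \<longlongrightarrow> 0) ?F" by (simp add: LIM_zero_iff)
  have "(\<lambda>x. s x - b * (x - \<alpha>) ^ 1) \<in> O[?F](\<lambda>x. (x - \<alpha>) ^ Suc 1)"
    using quad_expansion_linear[OF e s] by (simp add: numeral_2_eq_2)
  from bigo_leading_mult[OF e w this]
  have "(\<lambda>x. (x - \<alpha>) ^ 4 * (w x * s x - a * b * (x - \<alpha>) ^ (m + 1))) \<in> O[?F](\<lambda>x. (x - \<alpha>) ^ 4 * (x - \<alpha>) ^ Suc (m + 1))"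
    by (intro landau_o.big.mult landau_o.big_refl)
  then have "(\<lambda>x. (x - \<alpha>) ^ 4 * (w x * s x - a * b * (x - \<alpha>) ^ (m + 1))) \<in> O[?F](\<lambda>x. (x - \<alpha>) ^ (m + 5 + 1))"
    by (simp add: power_numeral_reduce power_add mult_ac)
  from sum_in_bigo(1)[OF landau_o.big_trans[OF st power_in_bigo_power[OF e]] this]
  have "(\<lambda>x. (scheme_step f A x - \<alpha>) - a * b * (x - \<alpha>) ^ (m + 5)) \<in> O[?F](\<lambda>x. (x - \<alpha>) ^ (m + 5 + 1))"
    using \<open>m \<le> 2\<close> by (simp add: power_numeral_reduce power_add algebra_simps)
  then show ?thesis
    unfolding order_at_least_def by (rule exI)
qed

theorem theorem2:
  fixes f A :: "real \<Rightarrow> real" and D U :: "real set" and \<alpha> :: real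
  assumes "open D" and "is_interval D"
    and "cont_diff_on 5 f D"
    and "\<alpha> \<in> D" and "f \<alpha> = 0" and "deriv f \<alpha> \<noteq> 0"
    and "open U" and "0 \<in> U" and "cont_diff_on 3 A U"
  shows "(A 0 = 1 \<longrightarrow> locally_convergent f A \<alpha> \<and> order_at_least 6 f A \<alpha>) \<and>
         (A 0 = 1 \<and> deriv A 0 = 2 \<longrightarrow> locally_convergent f A \<alpha> \<and> order_at_least 7 f A \<alpha>)"
proof -
  let ?F = "at \<alpha> within {x. step_defined f A x}"
  have e: "((\<lambda>x. x - \<alpha>) \<longlongrightarrow> 0) ?F" by (simp add: LIM_zero_iff)
  define d where "d m = (deriv ^^ m) (deriv f) \<alpha>" for m
  have "cont_diff_on 4 (deriv f) D"
    by (rule cont_diff_on_deriv) (use assms(3) in simp)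
  from cont_diff_on_taylor[OF \<open>open D\<close> this \<open>\<alpha> \<in> D\<close>]
  \<comment> \<open>Since \<open>d m\<close> is the derivative of \<open>f\<close> of order
    \<open>m + 1\<close>, the Taylor coefficients of \<open>f\<close> are \<open>d 1 / 2\<close>,
    \<open>d 2 / 6\<close> and \<open>d 3 / 24\<close>; the outer factors 2, 3 and 4 come from
    differentiating.\<close>
  have f': "(\<lambda>h. deriv f (\<alpha> + h) - (deriv f \<alpha> + 2 * (d 1 / 2) * h + 3 * (d 2 / 6) * h ^ 2 + 4 * (d 3 / 24) * h ^ 3))
      \<in> O[nhds 0](\<lambda>h. h ^ 4)"
    by (simp add: d_def eval_nat_numeral)
  have diff: "eventually (\<lambda>h. f differentiable (at (\<alpha> + h))) (nhds 0)"
  proof -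
    have "((\<lambda>h. \<alpha> + h) \<longlongrightarrow> \<alpha> + 0) (nhds 0)" by (intro tendsto_intros filterlim_ident)
    then have "eventually (\<lambda>h. \<alpha> + h \<in> D) (nhds 0)"
      using \<open>open D\<close> \<open>\<alpha> \<in> D\<close> by (intro topological_tendstoD) simp_all
    then show ?thesis
    proof eventually_elim
      case (elim h)
      then show ?case
        using cont_diff_on_DERIV[OF \<open>open D\<close> assms(3), of 0 "\<alpha> + h"]
        by (auto simp: real_differentiable_def)
    qed
  qed
  have A: "quad_expansion (nhds 0) (\<lambda>t. t) A 1 (deriv A 0)" if "A 0 = 1"
  proof (rule quad_expansionI)
    show "(\<lambda>t. A t - (1 + deriv A 0 * t + (deriv ^^ 2) A 0 / 2 * t ^ 2)) \<in> O[nhds 0](\<lambda>t. t ^ 3)"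
      using cont_diff_on_taylor[OF \<open>open U\<close> assms(9) \<open>0 \<in> U\<close>] that by (simp add: eval_nat_numeral)
  qed
  have six: "order_at_least 6 f A \<alpha>" if A0: "A 0 = 1"
  proof -
    obtain w s b where w: "quad_expansion ?F (\<lambda>x. x - \<alpha>) w 0 ((2 - deriv A 0) * (d 1 / 2 / deriv f \<alpha>) ^ 2)"
      and s: "quad_expansion ?F (\<lambda>x. x - \<alpha>) s 0 b"
      and st: "(\<lambda>x. (scheme_step f A x - \<alpha>) - (x - \<alpha>) ^ 4 * (w x * s x)) \<in> O[?F](\<lambda>x. (x - \<alpha>) ^ 8)"
      using scheme_step_factorization[OF assms(5,6) diff f' A[OF A0]] by blast
    define c where "c = (2 - deriv A 0) * (d 1 / 2 / deriv f \<alpha>) ^ 2"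
    have "(\<lambda>x. w x - c * (x - \<alpha>) ^ 1) \<in> O[?F](\<lambda>x. (x - \<alpha>) ^ Suc 1)"
      using quad_expansion_linear[OF e w[folded c_def]] by (simp add: numeral_2_eq_2)
    from order_at_leastI[OF this s st] show ?thesis by simp
  qed
  moreover have "order_at_least 7 f A \<alpha>" if A0: "A 0 = 1" and A1: "deriv A 0 = 2"
  proof -
    obtain w s b where w: "quad_expansion ?F (\<lambda>x. x - \<alpha>) w 0 ((2 - deriv A 0) * (d 1 / 2 / deriv f \<alpha>) ^ 2)"
      and s: "quad_expansion ?F (\<lambda>x. x - \<alpha>) s 0 b"
      and st: "(\<lambda>x. (scheme_step f A x - \<alpha>) - (x - \<alpha>) ^ 4 * (w x * s x)) \<in> O[?F](\<lambda>x. (x - \<alpha>) ^ 8)"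
      using scheme_step_factorization[OF assms(5,6) diff f' A[OF A0]] by blast
    \<comment> \<open>With \<open>deriv A 0 = 2\<close> the linear coefficient of \<open>w\<close>
      is zero, so the existential quadratic coefficient becomes the leading one.\<close>
    obtain c where "(\<lambda>x. w x - c * (x - \<alpha>) ^ 2) \<in> O[?F](\<lambda>x. (x - \<alpha>) ^ Suc 2)"
      using w A1 by (auto simp: quad_expansion_def eval_nat_numeral)
    from order_at_leastI[OF this s st] show ?thesis by simp
  qed
  ultimately show ?thesis
    using order_at_least_imp_locally_convergent[of f \<alpha> 6 A] \<open>f \<alpha> = 0\<close> by auto
qed

end
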